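(* Each of the following four concrete categories, with its forgetful functor to $\mathbf{Set}$, is topological: the category $\mathbf{Entou}$ of entourage spaces, the category $\mathbf{SCoarse}$ of semi-coarse spaces, the category $\mathbf{QCoarse}$ of quasi-coarse spaces, and the category $\mathbf{Coarse}$ of coarse spaces (in all cases the morphisms are the bornologous maps).
   Context: For $E,F\subseteq X\times X$ put $E^{-1}=\{(x,y)\mid (y,x)\in E\}$, $E\circ F=\{(x,z)\mid \exists y\in X:\ (x,y)\in E,\ (y,z)\in F\}$, $\Delta_X=\{(x,x)\mid x\in X\}$. An entourage structure on a set $X$ is a family $\mathcal{E}$ of subsets of $X\times X$ that is closed under taking subsets and finite unions and satisfies $\Delta_X\in\mathcal{E}$. It is a semi-coarse structure if $E^{-1}\in\mathcal{E}$ for all $E\in\mathcal{E}$; a quasi-coarse structure if $E\circ F\in\mathcal{E}$ for all $E,F\in\mathcal{E}$; a coarse structure if it is both. The pair $(X,\mathcal{E})$ is then called an entourage space (semi-coarse, quasi-coarse, coarse space, respectively). A map $f\colon(X,\mathcal{E}_X)\to(Y,\mathcal{E}_Y)$ is bornologous if $(f\times f)(E)\in\mathcal{E}_Y$ for every $E\in\mathcal{E}_X$. $\mathbf{Entou}$ has entourage spaces as objects and bornologous maps as morphisms; $\mathbf{SCoarse}$, $\mathbf{QCoarse}$, $\mathbf{Coarse}$ are its full subcategories of semi-coarse, quasi-coarse and coarse spaces. A concrete category is a pair $(\mathcal{X},U)$ with $U\colon\mathcal{X}\to\mathbf{Set}$ a faithful functor. For objects $X,Y$ of $\mathcal{X}$,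 a map $f\colon UX\to UY$ is called an $\mathcal{X}$-morphism if $f=U\overline f$ for some $\overline f\in\operatorname{Mor}_{\mathcal{X}}(X,Y)$. The fiber of a set $A$ is the family of all objects $X$ with $UX=A$. A source is a family (possibly a proper class) of morphisms $\{f_i\colon X\to X_i\}_{i\in I}$. A source $\{f_i\colon X\to X_i\}_{i\in I}$ in $\mathcal{X}$ is initial if every map $f\colon UA\to UX$ such that $Uf_i\circ f\colon UA\to UX_i$ is an $\mathcal{X}$-morphism for all $i\in I$ is itself an $\mathcal{X}$-morphism. An initial lifting of a source $\{f_i\colon A\to UX_i\}_{i\in I}$ in $\mathbf{Set}$ is an initial source $\{g_i\colon B\to X_i\}_{i\in I}$ in $\mathcal{X}$ with $UB=A$ and $Ug_i=f_i$ for all $i$. A concrete category $(\mathcal{X},U)$ is topological if: (a) $U$ is amnestic, i.e. $f=1_X$ whenever $f\colon X\to X$ is an isomorphism of $\mathcal{X}$ with $Uf=1_{UX}$; (b) $U$ is transportable, i.e. for every object $A$ of $\mathcal{X}$ and every bijection $h\colon UA\to X$ there are an object $B$ of $\mathcal{X}$ and an isomorphism $f\colon A\to B$ of $\mathcal{X}$ with $Uf=h$; (c) constant maps are morphisms of $\mathcal{X}$; (d) the fibers of $U$ are sets; (e) every singleton set has a unique element in its fiber; (f) every source $\{f_i\colon A\to UX_i\}_{i\in I}$ in $\mathbf{Set}$ has an initial lifting. *)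

theory Defs
  imports Main "HOL-Library.FuncSet" "HOL-Library.Equipollence"
begin

text \<open>
  Sets and classes.  HOL has no type of all sets, so the category of sets is formed relative to an
  arbitrary collection \<open>\<U>\<close> of subsets of an arbitrary type \<open>'u\<close>: the
  members of \<open>\<U>\<close> are the objects of \<open>Set\<close>.  Nothing is assumed of
  \<open>\<U>\<close>.  It may be \<open>UNIV\<close> (all subsets of \<open>'u\<close>), or
  the collection of the small subsets of a type \<open>'u\<close> that models ZFC; in the second case
  arbitrary HOL sets play the role of classes.
\<close>


section \<open>Categories and functors\<close>

text \<open>Hom-sets of different pairs of objects may overlap, so whatever depends on a morphism also
  takes its domain and codomain.  \<open>cmp C X Y Z g f\<close> is \<open>g \<circ> f\<close> for
  \<open>f : X \<rightarrow> Y\<close> and \<open>g : Y \<rightarrow> Z\<close>.\<close>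

record ('o, 'm) cat =
  obj :: "'o set"
  mor :: "'o \<Rightarrow> 'o \<Rightarrow> 'm set"
  ident :: "'o \<Rightarrow> 'm"
  cmp :: "'o \<Rightarrow> 'o \<Rightarrow> 'o \<Rightarrow> 'm \<Rightarrow> 'm \<Rightarrow> 'm"

definition category :: "('o, 'm) cat \<Rightarrow> bool" where
  "category C \<longleftrightarrow>
     (\<forall>X\<in>obj C. ident C X \<in> mor C X X) \<and>
     (\<forall>X\<in>obj C. \<forall>Y\<in>obj C. \<forall>Z\<in>obj C. \<forall>f\<in>mor C X Y. \<forall>g\<in>mor C Y Z.
        cmp C X Y Z g f \<in> mor C X Z) \<and>
     (\<forall>X\<in>obj C. \<forall>Y\<in>obj C. \<forall>f\<in>mor C X Y.
        cmp C X X Y f (ident C X) = f \<and> cmp C X Y Y (ident C Y) f = f) \<and>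
     (\<forall>W\<in>obj C. \<forall>X\<in>obj C. \<forall>Y\<in>obj C. \<forall>Z\<in>obj C.
        \<forall>f\<in>mor C W X. \<forall>g\<in>mor C X Y. \<forall>h\<in>mor C Y Z.
        cmp C W Y Z h (cmp C W X Y g f) = cmp C W X Z (cmp C X Y Z h g) f)"

definition iso :: "('o, 'm) cat \<Rightarrow> 'o \<Rightarrow> 'o \<Rightarrow> 'm \<Rightarrow> bool" where
  "iso C X Y f \<longleftrightarrow>
     f \<in> mor C X Y \<and>
     (\<exists>g\<in>mor C Y X. cmp C X Y X g f = ident C X \<and> cmp C Y X Y f g = ident C Y)"

definition full_subcategory :: "('o, 'm) cat \<Rightarrow> ('o \<Rightarrow> bool) \<Rightarrow> ('o, 'm) cat" where
  "full_subcategory C P = C\<lparr>obj := {X \<in> obj C. P X}\<rparr>"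

record ('o, 'm, 'p, 'n) funct =
  fobj :: "'o \<Rightarrow> 'p"
  fmor :: "'o \<Rightarrow> 'o \<Rightarrow> 'm \<Rightarrow> 'n"

definition is_functor :: "('o, 'm) cat \<Rightarrow> ('p, 'n) cat \<Rightarrow> ('o, 'm, 'p, 'n) funct \<Rightarrow> bool" where
  "is_functor C D F \<longleftrightarrow>
     (\<forall>X\<in>obj C. fobj F X \<in> obj D) \<and>
     (\<forall>X\<in>obj C. \<forall>Y\<in>obj C. \<forall>f\<in>mor C X Y. fmor F X Y f \<in> mor D (fobj F X) (fobj F Y)) \<and>
     (\<forall>X\<in>obj C. fmor F X X (ident C X) = ident D (fobj F X)) \<and>
     (\<forall>X\<in>obj C. \<forall>Y\<in>obj C. \<forall>Z\<in>obj C. \<forall>f\<in>mor C X Y. \<forall>g\<in>mor C Y Z.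
        fmor F X Z (cmp C X Y Z g f) =
          cmp D (fobj F X) (fobj F Y) (fobj F Z) (fmor F Y Z g) (fmor F X Y f))"

definition faithful :: "('o, 'm) cat \<Rightarrow> ('o, 'm, 'p, 'n) funct \<Rightarrow> bool" where
  "faithful C F \<longleftrightarrow> (\<forall>X\<in>obj C. \<forall>Y\<in>obj C. inj_on (fmor F X Y) (mor C X Y))"


section \<open>The category of sets\<close>

text \<open>Maps \<open>A \<rightarrow> B\<close> are extensional (\<open>undefined\<close> outside \<open>A\<close>),
  so that HOL equality of two of them is equality of maps on \<open>A\<close>.\<close>

definition Set_cat :: "'u set set \<Rightarrow> ('u set, 'u \<Rightarrow> 'u) cat" where
  "Set_cat \<U> = \<lparr>obj = \<U>,
     mor = (\<lambda>A B. A \<rightarrow>\<^sub>E B),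
     ident = (\<lambda>A. \<lambda>x\<in>A. x),
     cmp = (\<lambda>A B C g f. compose A g f)\<rparr>"

text \<open>A collection of arbitrary objects counts as a set, as opposed to a proper class, if its size is
  bounded by that of a finitely iterated power set of a member of \<open>\<U>\<close>.  No generality
  is lost by taking the intermediate collection \<open>D\<close> in the same type as \<open>C\<close>, for it can
  be chosen inside \<open>C\<close>.  If \<open>\<U>\<close> itself is closed under power sets up to
  bijection, the iteration collapses; see \<open>set_sized_iff\<close> below.\<close>

inductive set_sized :: "'u set set \<Rightarrow> 'o set \<Rightarrow> bool" for \<U> :: "'u set set" where
  base: "A \<in> \<U> \<Longrightarrow> C \<lesssim> A \<Longrightarrow> set_sized \<U> C"
| power: "set_sized \<U> D \<Longrightarrow> C \<lesssim> Pow D \<Longrightarrow> set_sized \<U> C"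

lemma lepoll_Pow_mono: "A \<lesssim> B \<Longrightarrow> Pow A \<lesssim> Pow B"
  unfolding lepoll_def using inj_on_image_Pow image_Pow_mono by meson

lemma set_sized_iff:
  assumes subset: "\<And>A B. A \<in> \<U> \<Longrightarrow> B \<subseteq> A \<Longrightarrow> B \<in> \<U>"
    and power: "\<And>A. A \<in> \<U> \<Longrightarrow> \<exists>B\<in>\<U>. Pow A \<approx> B"
  shows "set_sized \<U> C \<longleftrightarrow> (\<exists>B\<in>\<U>. C \<approx> B)"
proof
  assume "set_sized \<U> C"
  then have "\<exists>A\<in>\<U>. C \<lesssim> A"
  proof induction
    case (power D C)
    then obtain A where "A \<in> \<U>" "D \<lesssim> A" by blast
    moreover obtain B where "B \<in> \<U>" "Pow A \<approx> B" using assms(2) \<open>A \<in> \<U>\<close> by blast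
    ultimately show ?case
      using power.hyps(2) by (meson lepoll_Pow_mono lepoll_trans lepoll_trans1 eqpoll_imp_lepoll)
  qed blast
  then obtain A f where "A \<in> \<U>" "inj_on f C" "f ` C \<subseteq> A"
    unfolding lepoll_def by blast
  then show "\<exists>B\<in>\<U>. C \<approx> B"
    by (meson subset eqpoll_sym inj_on_image_eqpoll_self)
next
  assume "\<exists>B\<in>\<U>. C \<approx> B"
  then show "set_sized \<U> C"
    by (meson eqpoll_imp_lepoll set_sized.base)
qed


section \<open>Topological categories\<close>

definition concrete_category ::
    "'u set set \<Rightarrow> ('o, 'm) cat \<Rightarrow> ('o, 'm, 'u set, 'u \<Rightarrow> 'u) funct \<Rightarrow> bool" where
  "concrete_category \<U> C U \<longleftrightarrow> category C \<and> is_functor C (Set_cat \<U>) U \<and> faithful C U"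

text \<open>The map \<open>f : U X \<rightarrow> U Y\<close> underlies a morphism \<open>X \<rightarrow> Y\<close>.\<close>

definition is_morphism ::
    "('o, 'm) cat \<Rightarrow> ('o, 'm, 'u set, 'u \<Rightarrow> 'u) funct \<Rightarrow> 'o \<Rightarrow> 'o \<Rightarrow> ('u \<Rightarrow> 'u) \<Rightarrow> bool" where
  "is_morphism C U X Y f \<longleftrightarrow> (\<exists>g\<in>mor C X Y. fmor U X Y g = f)"

definition fiber :: "('o, 'm) cat \<Rightarrow> ('o, 'm, 'u set, 'u \<Rightarrow> 'u) funct \<Rightarrow> 'u set \<Rightarrow> 'o set" where
  "fiber C U A = {X \<in> obj C. fobj U X = A}"

definition is_source :: "('o, 'm) cat \<Rightarrow> 'o \<Rightarrow> 'i set \<Rightarrow> ('i \<Rightarrow> 'o) \<Rightarrow> ('i \<Rightarrow> 'm) \<Rightarrow> bool" where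
  "is_source C X I Xs fs \<longleftrightarrow> X \<in> obj C \<and> (\<forall>i\<in>I. Xs i \<in> obj C \<and> fs i \<in> mor C X (Xs i))"

definition initial_source ::
    "'u set set \<Rightarrow> ('o, 'm) cat \<Rightarrow> ('o, 'm, 'u set, 'u \<Rightarrow> 'u) funct \<Rightarrow>
      'o \<Rightarrow> 'i set \<Rightarrow> ('i \<Rightarrow> 'o) \<Rightarrow> ('i \<Rightarrow> 'm) \<Rightarrow> bool" where
  "initial_source \<U> C U X I Xs fs \<longleftrightarrow>
     is_source C X I Xs fs \<and>
     (\<forall>A\<in>obj C. \<forall>f\<in>mor (Set_cat \<U>) (fobj U A) (fobj U X).
        (\<forall>i\<in>I. is_morphism C U A (Xs i)
           (cmp (Set_cat \<U>) (fobj U A) (fobj U X) (fobj U (Xs i)) (fmor U X (Xs i) (fs i)) f))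
        \<longrightarrow> is_morphism C U A X f)"

definition initial_lifting ::
    "'u set set \<Rightarrow> ('o, 'm) cat \<Rightarrow> ('o, 'm, 'u set, 'u \<Rightarrow> 'u) funct \<Rightarrow>
      'u set \<Rightarrow> 'i set \<Rightarrow> ('i \<Rightarrow> 'o) \<Rightarrow> ('i \<Rightarrow> 'u \<Rightarrow> 'u) \<Rightarrow> 'o \<Rightarrow> ('i \<Rightarrow> 'm) \<Rightarrow> bool" where
  "initial_lifting \<U> C U A I Xs fs B gs \<longleftrightarrow>
     initial_source \<U> C U B I Xs gs \<and> fobj U B = A \<and> (\<forall>i\<in>I. fmor U B (Xs i) (gs i) = fs i)"

definition amnestic :: "'u set set \<Rightarrow> ('o, 'm) cat \<Rightarrow> ('o, 'm, 'u set, 'u \<Rightarrow> 'u) funct \<Rightarrow> bool" where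
  "amnestic \<U> C U \<longleftrightarrow>
     (\<forall>X\<in>obj C. \<forall>f. iso C X X f \<and> fmor U X X f = ident (Set_cat \<U>) (fobj U X) \<longrightarrow> f = ident C X)"

text \<open>Extensional functions do not record their codomain, so \<open>U f = h\<close> as morphisms of
  \<open>Set\<close> includes the explicit equation \<open>U B = X\<close>.\<close>

definition transportable ::
    "'u set set \<Rightarrow> ('o, 'm) cat \<Rightarrow> ('o, 'm, 'u set, 'u \<Rightarrow> 'u) funct \<Rightarrow> bool" where
  "transportable \<U> C U \<longleftrightarrow>
     (\<forall>A\<in>obj C. \<forall>X\<in>obj (Set_cat \<U>). \<forall>h\<in>mor (Set_cat \<U>) (fobj U A) X. bij_betw h (fobj U A) X \<longrightarrow>
        (\<exists>B\<in>obj C. \<exists>f. iso C A B f \<and> fobj U B = X \<and> fmor U A B f = h))"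

text \<open>The index type \<open>'i\<close> of the sources in the last condition is a parameter, passed as
  \<open>TYPE('i)\<close>, and the index family is an arbitrary subset of it; in particular, its size is not
  bounded by \<open>\<U>\<close>.\<close>

definition topological ::
    "'i itself \<Rightarrow> 'u set set \<Rightarrow> ('o, 'm) cat \<Rightarrow> ('o, 'm, 'u set, 'u \<Rightarrow> 'u) funct \<Rightarrow> bool" where
  "topological _ \<U> C U \<longleftrightarrow>
     concrete_category \<U> C U \<and>
     amnestic \<U> C U \<and>
     transportable \<U> C U \<and>
     (\<forall>X\<in>obj C. \<forall>Y\<in>obj C. \<forall>f\<in>mor (Set_cat \<U>) (fobj U X) (fobj U Y).
        (\<forall>x\<in>fobj U X. \<forall>y\<in>fobj U X. f x = f y) \<longrightarrow> is_morphism C U X Y f) \<and>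
     (\<forall>A\<in>obj (Set_cat \<U>). set_sized \<U> (fiber C U A)) \<and>
     (\<forall>A\<in>obj (Set_cat \<U>). is_singleton A \<longrightarrow> (\<exists>!X. X \<in> fiber C U A)) \<and>
     (\<forall>A (I :: 'i set) Xs fs.
        (\<forall>i\<in>I. Xs i \<in> obj C) \<and> is_source (Set_cat \<U>) A I (\<lambda>i. fobj U (Xs i)) fs \<longrightarrow>
        (\<exists>B gs. initial_lifting \<U> C U A I Xs fs B gs))"


section \<open>Entourage spaces\<close>

type_synonym 'u space = "'u set \<times> ('u \<times> 'u) set set"

definition entourage_structure :: "'u set \<Rightarrow> ('u \<times> 'u) set set \<Rightarrow> bool" where
  "entourage_structure X \<E> \<longleftrightarrow>
     \<E> \<subseteq> Pow (X \<times> X) \<and>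
     (\<forall>E\<in>\<E>. \<forall>F. F \<subseteq> E \<longrightarrow> F \<in> \<E>) \<and>
     (\<forall>\<F>. finite \<F> \<and> \<F> \<subseteq> \<E> \<longrightarrow> \<Union>\<F> \<in> \<E>) \<and>
     Id_on X \<in> \<E>"

definition semi_coarse_structure :: "'u set \<Rightarrow> ('u \<times> 'u) set set \<Rightarrow> bool" where
  "semi_coarse_structure X \<E> \<longleftrightarrow> entourage_structure X \<E> \<and> (\<forall>E\<in>\<E>. E\<inverse> \<in> \<E>)"

definition quasi_coarse_structure :: "'u set \<Rightarrow> ('u \<times> 'u) set set \<Rightarrow> bool" where
  "quasi_coarse_structure X \<E> \<longleftrightarrow> entourage_structure X \<E> \<and> (\<forall>E\<in>\<E>. \<forall>F\<in>\<E>. E O F \<in> \<E>)"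

definition coarse_structure :: "'u set \<Rightarrow> ('u \<times> 'u) set set \<Rightarrow> bool" where
  "coarse_structure X \<E> \<longleftrightarrow> semi_coarse_structure X \<E> \<and> quasi_coarse_structure X \<E>"

definition bornologous :: "'u space \<Rightarrow> 'u space \<Rightarrow> ('u \<Rightarrow> 'u) \<Rightarrow> bool" where
  "bornologous X Y f \<longleftrightarrow> (\<forall>E\<in>snd X. map_prod f f ` E \<in> snd Y)"

definition Entou :: "'u set set \<Rightarrow> ('u space, 'u \<Rightarrow> 'u) cat" where
  "Entou \<U> = \<lparr>obj = {(X, \<E>). X \<in> \<U> \<and> entourage_structure X \<E>},
     mor = (\<lambda>X Y. {f \<in> fst X \<rightarrow>\<^sub>E fst Y. bornologous X Y f}),
     ident = (\<lambda>X. \<lambda>x\<in>fst X. x),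
     cmp = (\<lambda>X Y Z g f. compose (fst X) g f)\<rparr>"

definition SCoarse :: "'u set set \<Rightarrow> ('u space, 'u \<Rightarrow> 'u) cat" where
  "SCoarse \<U> = full_subcategory (Entou \<U>) (\<lambda>(X, \<E>). semi_coarse_structure X \<E>)"

definition QCoarse :: "'u set set \<Rightarrow> ('u space, 'u \<Rightarrow> 'u) cat" where
  "QCoarse \<U> = full_subcategory (Entou \<U>) (\<lambda>(X, \<E>). quasi_coarse_structure X \<E>)"

definition Coarse :: "'u set set \<Rightarrow> ('u space, 'u \<Rightarrow> 'u) cat" where
  "Coarse \<U> = full_subcategory (Entou \<U>) (\<lambda>(X, \<E>). coarse_structure X \<E>)"

definition forgetful :: "('u space, 'u \<Rightarrow> 'u, 'u set, 'u \<Rightarrow> 'u) funct" where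
  "forgetful = \<lparr>fobj = fst, fmor = (\<lambda>X Y f. f)\<rparr>"

end

theory Submission
  imports Defs
begin

text \<open>
  For maps \<open>f\<^sub>i : A \<rightarrow> X\<^sub>i\<close> into entourage spaces, the sets
  \<open>E \<subseteq> A \<times> A\<close> all of whose images \<open>(f\<^sub>i \<times> f\<^sub>i)(E)\<close> are entourages form
  the initial structure on \<open>A\<close>, and it inherits closure under inverses and under composition from the
  \<open>X\<^sub>i\<close>. Hence each of the four classes of spaces is closed under initial structures. This
  alone makes the corresponding full subcategory topological: transport along a bijection is the initial
  structure for the inverse map, and the empty source yields the only structure on a singleton.
\<close>

section \<open>Initial structures and the closure of the four classes of spaces under them\<close>

text \<open>The source is encoded as a set of pairs of a map and its target space, because only
  these pairs matter and no index type then appears. For empty \<open>M\<close> the result is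
  \<open>Pow (A \<times> A)\<close>.\<close>

definition initial_structure :: "'u set \<Rightarrow> (('u \<Rightarrow> 'u) \<times> 'u space) set \<Rightarrow> ('u \<times> 'u) set set" where
  "initial_structure A M = {E. E \<subseteq> A \<times> A \<and> (\<forall>(f, Y)\<in>M. map_prod f f ` E \<in> snd Y)}"

lemma initial_structureI:
  assumes "E \<subseteq> A \<times> A" "\<And>f Y. (f, Y) \<in> M \<Longrightarrow> map_prod f f ` E \<in> snd Y"
  shows "E \<in> initial_structure A M"
  using assms by (auto simp: initial_structure_def)

lemma initial_structureD:
  assumes "E \<in> initial_structure A M"
  shows "E \<subseteq> A \<times> A" "(f, Y) \<in> M \<Longrightarrow> map_prod f f ` E \<in> snd Y"
  using assms by (auto simp: initial_structure_def)

lemma entourage_structure_subset: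
  "entourage_structure X \<E> \<Longrightarrow> E \<in> \<E> \<Longrightarrow> F \<subseteq> E \<Longrightarrow> F \<in> \<E>"
  unfolding entourage_structure_def by blast

lemma entourage_structure_Union:
  "entourage_structure X \<E> \<Longrightarrow> finite \<F> \<Longrightarrow> \<F> \<subseteq> \<E> \<Longrightarrow> \<Union>\<F> \<in> \<E>"
  unfolding entourage_structure_def by blast

lemma entourage_structure_Id_on: "entourage_structure X \<E> \<Longrightarrow> Id_on X \<in> \<E>"
  unfolding entourage_structure_def by blast

lemma entourage_structure_carrier: "entourage_structure X \<E> \<Longrightarrow> E \<in> \<E> \<Longrightarrow> E \<subseteq> X \<times> X"
  unfolding entourage_structure_def by blast

text \<open>Taking images is monotone and commutes with unions, and it sends the diagonal of
  \<open>A\<close> into the diagonal of \<open>fst Y\<close>, so each closure property is pulled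
  back from the targets.\<close>

lemma entourage_structure_initial:
  assumes "\<And>f Y. (f, Y) \<in> M \<Longrightarrow> f \<in> A \<rightarrow> fst Y \<and> entourage_structure (fst Y) (snd Y)"
  shows "entourage_structure A (initial_structure A M)"
  unfolding entourage_structure_def
proof (intro conjI ballI allI impI)
  show "initial_structure A M \<subseteq> Pow (A \<times> A)"
    by (auto simp: initial_structure_def)
next
  fix E F assume E: "E \<in> initial_structure A M" "F \<subseteq> E"
  show "F \<in> initial_structure A M"
  proof (rule initial_structureI)
    show "F \<subseteq> A \<times> A"
      using initial_structureD(1)[OF E(1)] E(2) by blast
    show "map_prod f f ` F \<in> snd Y" if "(f, Y) \<in> M" for f Y
      using assms[OF that, THEN conjunct2] initial_structureD(2)[OF E(1) that] image_mono[OF E(2)]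
      by (rule entourage_structure_subset)
  qed
next
  fix \<F> assume \<F>: "finite \<F> \<and> \<F> \<subseteq> initial_structure A M"
  show "\<Union>\<F> \<in> initial_structure A M"
  proof (rule initial_structureI)
    show "\<Union>\<F> \<subseteq> A \<times> A"
      using \<F> initial_structureD(1) by blast
  next
    fix f Y assume fY: "(f, Y) \<in> M"
    have "image (map_prod f f) ` \<F> \<subseteq> snd Y"
    proof
      fix E assume "E \<in> image (map_prod f f) ` \<F>"
      then show "E \<in> snd Y"
        using \<F> initial_structureD(2)[OF _ fY] by blast
    qed
    then show "map_prod f f ` \<Union>\<F> \<in> snd Y"
      using assms[OF fY] \<F> entourage_structure_Union[of "fst Y" "snd Y" "image (map_prod f f) ` \<F>"]
      by (simp add: image_Union)
  qed
next
  show "Id_on A \<in> initial_structure A M"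
  proof (rule initial_structureI)
    show "Id_on A \<subseteq> A \<times> A"
      by auto
  next
    fix f Y assume fY: "(f, Y) \<in> M"
    have "map_prod f f ` Id_on A \<subseteq> Id_on (fst Y)"
      using assms[OF fY] by (auto simp: Id_on_iff)
    then show "map_prod f f ` Id_on A \<in> snd Y"
      using assms[OF fY] entourage_structure_subset[of "fst Y" "snd Y" "Id_on (fst Y)"]
        entourage_structure_Id_on[of "fst Y" "snd Y"]
      by simp
  qed
qed

text \<open>Taking images under \<open>map_prod f f\<close> commutes with inversion of
  relations.\<close>

lemma semi_coarse_structure_initial:
  assumes "\<And>f Y. (f, Y) \<in> M \<Longrightarrow> f \<in> A \<rightarrow> fst Y \<and> semi_coarse_structure (fst Y) (snd Y)"
  shows "semi_coarse_structure A (initial_structure A M)"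
  unfolding semi_coarse_structure_def
proof (intro conjI ballI)
  show "entourage_structure A (initial_structure A M)"
    using assms by (intro entourage_structure_initial) (auto simp: semi_coarse_structure_def)
next
  fix E assume E: "E \<in> initial_structure A M"
  have "map_prod f f ` (E\<inverse>) \<in> snd Y" if "(f, Y) \<in> M" for f Y
  proof -
    have "map_prod f f ` (E\<inverse>) = (map_prod f f ` E)\<inverse>"
      by force
    then show ?thesis
      using assms[OF that] initial_structureD(2)[OF E that] by (simp add: semi_coarse_structure_def)
  qed
  then show "E\<inverse> \<in> initial_structure A M"
    using initial_structureD(1)[OF E] by (intro initial_structureI) auto
qed

text \<open>The image of a composite is in general only contained in the composite of the images,
  since \<open>f\<close> may identify different intermediate points. Closure under subsets in the
  target makes the inclusion sufficient.\<close>

lemma quasi_coarse_structure_initial: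
  assumes "\<And>f Y. (f, Y) \<in> M \<Longrightarrow> f \<in> A \<rightarrow> fst Y \<and> quasi_coarse_structure (fst Y) (snd Y)"
  shows "quasi_coarse_structure A (initial_structure A M)"
  unfolding quasi_coarse_structure_def
proof (intro conjI ballI)
  show "entourage_structure A (initial_structure A M)"
    using assms by (intro entourage_structure_initial) (auto simp: quasi_coarse_structure_def)
next
  fix E F assume EF: "E \<in> initial_structure A M" "F \<in> initial_structure A M"
  have "map_prod f f ` (E O F) \<in> snd Y" if "(f, Y) \<in> M" for f Y
  proof -
    have "map_prod f f ` (E O F) \<subseteq> map_prod f f ` E O map_prod f f ` F"
      by force
    moreover have "map_prod f f ` E O map_prod f f ` F \<in> snd Y"
      using assms[OF that] EF[THEN initial_structureD(2), OF that]
      by (simp add: quasi_coarse_structure_def)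
    ultimately show ?thesis
      using assms[OF that] entourage_structure_subset[of "fst Y" "snd Y"]
      by (simp add: quasi_coarse_structure_def)
  qed
  then show "E O F \<in> initial_structure A M"
    using EF[THEN initial_structureD(1)] by (intro initial_structureI) auto
qed

lemma coarse_structure_initial:
  assumes "\<And>f Y. (f, Y) \<in> M \<Longrightarrow> f \<in> A \<rightarrow> fst Y \<and> coarse_structure (fst Y) (snd Y)"
  shows "coarse_structure A (initial_structure A M)"
  using assms unfolding coarse_structure_def
  by (simp add: semi_coarse_structure_initial quasi_coarse_structure_initial)

section \<open>Images of relations under identities and composites of extensional maps\<close>

lemma map_prod_image_id_on:
  assumes "E \<subseteq> A \<times> A" "\<And>x. x \<in> A \<Longrightarrow> f x = x"
  shows "map_prod f f ` E = E"
proof -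
  have "map_prod f f ` E = id ` E"
    using assms by (intro image_cong) auto
  then show ?thesis
    by simp
qed

lemma map_prod_image_compose:
  "E \<subseteq> A \<times> A \<Longrightarrow>
    map_prod (compose A g f) (compose A g f) ` E = map_prod g g ` map_prod f f ` E"
  unfolding image_image by (intro image_cong) (auto simp: compose_eq)

section \<open>The size of the fibers\<close>

text \<open>A structure on \<open>A\<close> is a member of \<open>Pow (Pow (A \<times> A))\<close>.
  Since \<open>A \<times> A\<close> embeds into \<open>Pow (Pow A)\<close>, four power set steps
  starting from \<open>A\<close> bound all of them.\<close>

lemma set_sized_entourage_structures:
  assumes "A \<in> \<U>"
  shows "set_sized \<U> ({A} \<times> {\<E>. \<E> \<subseteq> Pow (A \<times> A)} :: 'u space set)"
proof -
  \<comment> \<open>copies of the iterated power sets inside the type of spaces, since \<open>set_sized\<close> iterates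
    within one type\<close>
  define D0 D1 D2 D3 :: "'u space set"
    where "D0 = (\<lambda>x. ({x}, {})) ` A"
      and "D1 = (\<lambda>S. (S, {})) ` Pow A"
      and "D2 = (\<lambda>\<S>. ({}, Id_on ` \<S>)) ` Pow (Pow A)"
      and "D3 = (\<lambda>E. ({}, {E})) ` Pow (A \<times> A)"
  \<comment> \<open>Replacing a subset of \<open>A\<close> by its diagonal turns a family of subsets
    into a family of relations, which fits into the second component of a space.\<close>
  have inj_Id_on: "inj (Id_on :: 'u set \<Rightarrow> _)"
    by (rule injI) (auto simp: Id_on_def)
  have D0: "D0 \<approx> A"
    unfolding D0_def by (rule inj_on_image_eqpoll_self) (auto intro: inj_onI)
  have D1: "D1 \<approx> Pow A"
    unfolding D1_def by (rule inj_on_image_eqpoll_self) (auto intro: inj_onI)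
  have D2: "D2 \<approx> Pow (Pow A)"
    unfolding D2_def
    by (rule inj_on_image_eqpoll_self) (auto intro!: inj_onI simp: inj_image_eq_iff[OF inj_Id_on])
  have D3: "D3 \<approx> Pow (A \<times> A)"
    unfolding D3_def by (rule inj_on_image_eqpoll_self) (auto intro: inj_onI)
  have pairs: "A \<times> A \<lesssim> Pow (Pow A)"
    \<comment> \<open>Kuratowski pairs\<close>
    unfolding lepoll_def
    by (rule exI[of _ "\<lambda>(x, y). {{x}, {x, y}}"]) (auto intro!: inj_onI simp: doubleton_eq_iff)
  have "set_sized \<U> D0"
    using assms D0 by (blast intro: set_sized.base eqpoll_imp_lepoll)
  moreover have "D1 \<lesssim> Pow D0"
    using D0 D1 by (meson eqpoll_imp_lepoll eqpoll_sym lepoll_Pow_mono lepoll_trans)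
  ultimately have "set_sized \<U> D1"
    by (rule set_sized.power)
  moreover have "D2 \<lesssim> Pow D1"
    using D1 D2 by (meson eqpoll_imp_lepoll eqpoll_sym lepoll_Pow_mono lepoll_trans)
  ultimately have "set_sized \<U> D2"
    by (rule set_sized.power)
  moreover have "D3 \<lesssim> Pow D2"
    using D2 D3 pairs by (meson eqpoll_imp_lepoll eqpoll_sym lepoll_Pow_mono lepoll_trans)
  ultimately have "set_sized \<U> D3"
    by (rule set_sized.power)
  moreover have "{A} \<times> {\<E>. \<E> \<subseteq> Pow (A \<times> A)} \<lesssim> Pow (Pow (A \<times> A))"
    unfolding lepoll_def by (rule exI[of _ snd]) (auto intro: inj_onI)
  then have "{A} \<times> {\<E>. \<E> \<subseteq> Pow (A \<times> A)} \<lesssim> Pow D3"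
    using D3 by (meson eqpoll_imp_lepoll eqpoll_sym lepoll_Pow_mono lepoll_trans)
  ultimately show ?thesis
    by (rule set_sized.power)
qed

text \<open>Both introduction rules end with an upper bound on the cardinality of \<open>C\<close>,
  which a subset inherits, so a case distinction on the last rule is enough.\<close>

lemma set_sized_subset:
  assumes "set_sized \<U> C" "D \<subseteq> C"
  shows "set_sized \<U> D"
  using assms(1)
proof cases
  case (base A)
  then show ?thesis
    using lepoll_trans[OF subset_imp_lepoll[OF assms(2)]] by (blast intro: set_sized.base)
next
  case (power C')
  then show ?thesis
    using lepoll_trans[OF subset_imp_lepoll[OF assms(2)]] by (blast intro: set_sized.power)
qed

section \<open>Classes of spaces closed under initial structures give topological categories\<close>

text \<open>This is the common abstraction of the four cases: \<open>P\<close> singles out the full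
  subcategory, and the assumption says that the initial structure of a source into spaces with
  \<open>P\<close> again has \<open>P\<close>.\<close>

locale initially_closed =
  fixes \<U> :: "'u set set" and P :: "'u space \<Rightarrow> bool"
  assumes P_initial:
    "(\<And>f Y. (f, Y) \<in> M \<Longrightarrow> f \<in> A \<rightarrow> fst Y \<and> entourage_structure (fst Y) (snd Y) \<and> P Y)
      \<Longrightarrow> P (A, initial_structure A M)"
begin

abbreviation "\<C> \<equiv> full_subcategory (Entou \<U>) P"

lemma obj_iff: "X \<in> obj \<C> \<longleftrightarrow> fst X \<in> \<U> \<and> entourage_structure (fst X) (snd X) \<and> P X"
  by (auto simp: full_subcategory_def Entou_def)

lemma mor_iff: "f \<in> mor \<C> X Y \<longleftrightarrow> f \<in> fst X \<rightarrow>\<^sub>E fst Y \<and> bornologous X Y f"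
  by (simp add: full_subcategory_def Entou_def)

lemma cat_sel [simp]:
  "ident \<C> X = (\<lambda>x\<in>fst X. x)"
  "cmp \<C> X Y Z g f = compose (fst X) g f"
  "fobj forgetful = fst"
  "fmor forgetful X Y f = f"
  "obj (Set_cat \<U>) = \<U>"
  "mor (Set_cat \<U>) A B = A \<rightarrow>\<^sub>E B"
  "ident (Set_cat \<U>) A = (\<lambda>x\<in>A. x)"
  "cmp (Set_cat \<U>) A B C g' f' = compose A g' f'"
  by (simp_all add: full_subcategory_def Entou_def forgetful_def Set_cat_def)

lemma is_morphism_iff: "is_morphism \<C> forgetful X Y f \<longleftrightarrow> f \<in> mor \<C> X Y"
  by (simp add: is_morphism_def)

lemma obj_carrier: "X \<in> obj \<C> \<Longrightarrow> E \<in> snd X \<Longrightarrow> E \<subseteq> fst X \<times> fst X"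
  using entourage_structure_carrier[of "fst X" "snd X" E] by (simp add: obj_iff)

lemma ident_mor: "X \<in> obj \<C> \<Longrightarrow> (\<lambda>x\<in>fst X. x) \<in> mor \<C> X X"
  unfolding mor_iff bornologous_def
  using map_prod_image_id_on[OF obj_carrier, of X _ "\<lambda>x\<in>fst X. x"] by auto

lemma compose_mor:
  assumes "X \<in> obj \<C>" "f \<in> mor \<C> X Y" "g \<in> mor \<C> Y Z"
  shows "compose (fst X) g f \<in> mor \<C> X Z"
  using assms map_prod_image_compose[OF obj_carrier[OF assms(1)], of _ g f]
  unfolding mor_iff bornologous_def by (auto simp: compose_def)

lemma category: "category \<C>"
  unfolding category_def
proof (intro conjI ballI)
  fix X Y f assume "X \<in> obj \<C>" "Y \<in> obj \<C>" and f: "f \<in> mor \<C> X Y"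
  show "cmp \<C> X X Y f (ident \<C> X) = f" "cmp \<C> X Y Y (ident \<C> Y) f = f"
    using f by (auto simp: mor_iff fun_eq_iff compose_def PiE_def Pi_def extensional_def)
next
  fix W X Y Z f g h
  assume "f \<in> mor \<C> W X"
  then show "cmp \<C> W Y Z h (cmp \<C> W X Y g f) = cmp \<C> W X Z (cmp \<C> X Y Z h g) f"
    by (auto simp: mor_iff fun_eq_iff compose_def)
qed (use ident_mor compose_mor in auto)

lemma concrete_category: "concrete_category \<U> \<C> forgetful"
  unfolding concrete_category_def is_functor_def faithful_def
  using category by (auto simp: obj_iff mor_iff inj_on_def)

lemma initial_obj:
  assumes "A \<in> \<U>" "\<And>f Y. (f, Y) \<in> M \<Longrightarrow> f \<in> A \<rightarrow> fst Y \<and> Y \<in> obj \<C>"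
  shows "(A, initial_structure A M) \<in> obj \<C>"
  using assms entourage_structure_initial[of M A] P_initial[of M A] by (simp add: obj_iff)

lemma transportable: "transportable \<U> \<C> forgetful"
  unfolding transportable_def
proof (intro ballI impI)
  fix A X h
  assume A: "A \<in> obj \<C>" and "X \<in> obj (Set_cat \<U>)" and "h \<in> mor (Set_cat \<U>) (fobj forgetful A) X"
    and "bij_betw h (fobj forgetful A) X"
  then have X: "X \<in> \<U>" and h: "h \<in> fst A \<rightarrow>\<^sub>E X" and bij: "bij_betw h (fst A) X"
    by simp_all
  \<comment> \<open>The restriction makes the inverse extensional, as maps in \<open>Set_cat\<close>
    must be.\<close>
  define g where "g = restrict (inv_into (fst A) h) X"
  have g: "g \<in> X \<rightarrow>\<^sub>E fst A"
    using bij by (auto simp: g_def bij_betw_def inv_into_into)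
  have gh: "g (h x) = x" if "x \<in> fst A" for x
    using that bij h by (auto simp: g_def bij_betw_def)
  have hg: "h (g y) = y" if "y \<in> X" for y
    using that bij by (auto simp: g_def bij_betw_def f_inv_into_f)
  \<comment> \<open>With this structure \<open>g\<close> is bornologous by construction.\<close>
  define B where "B = (X, initial_structure X {(g, A)})"
  have B: "B \<in> obj \<C>"
    unfolding B_def using X A g by (intro initial_obj) auto
  have "map_prod h h ` E \<in> snd B" if "E \<in> snd A" for E
  proof -
    have E: "E \<subseteq> fst A \<times> fst A"
      using A that by (rule obj_carrier)
    \<comment> \<open>As \<open>g\<close> undoes \<open>h\<close>, the \<open>g\<close>-image of
      \<open>h(E)\<close> is the entourage \<open>E\<close> itself. This is the membership condition
      for \<open>h(E)\<close> in \<open>B\<close>, so \<open>h\<close> is bornologous.\<close>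
    have "map_prod g g ` map_prod h h ` E = E"
      using map_prod_image_id_on[OF E, of "compose (fst A) g h"] map_prod_image_compose[OF E, of g h] gh
      by (simp add: compose_eq)
    then show ?thesis
      using that E h by (auto simp: B_def initial_structure_def)
  qed
  then have h_mor: "h \<in> mor \<C> A B"
    using h by (simp add: mor_iff bornologous_def B_def)
  have g_mor: "g \<in> mor \<C> B A"
    using g by (auto simp: mor_iff bornologous_def B_def initial_structure_def)
  have "compose (fst A) g h = (\<lambda>x\<in>fst A. x)" "compose (fst B) h g = (\<lambda>x\<in>fst B. x)"
    using gh hg by (auto simp: compose_def B_def)
  then have "iso \<C> A B h"
    unfolding iso_def using h_mor g_mor by auto
  then show "\<exists>B\<in>obj \<C>. \<exists>f. iso \<C> A B f \<and> fobj forgetful B = X \<and> fmor forgetful A B f = h"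
    using B by (intro bexI[of _ B] exI[of _ h]) (simp_all add: B_def)
qed

text \<open>A constant map sends every relation on its domain into the diagonal of the codomain,
  which is an entourage.\<close>

lemma constant_mor:
  assumes "X \<in> obj \<C>" "Y \<in> obj \<C>" "f \<in> fst X \<rightarrow>\<^sub>E fst Y"
    and const: "\<forall>x\<in>fst X. \<forall>y\<in>fst X. f x = f y"
  shows "f \<in> mor \<C> X Y"
proof -
  have "map_prod f f ` E \<in> snd Y" if "E \<in> snd X" for E
  proof -
    have "E \<subseteq> fst X \<times> fst X"
      using assms(1) that by (rule obj_carrier)
    then have "map_prod f f ` E \<subseteq> Id_on (fst Y)"
      using assms(3) const by (fastforce simp: Id_on_iff)
    moreover have "Id_on (fst Y) \<in> snd Y"
      using assms(2) by (simp add: obj_iff entourage_structure_Id_on)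
    ultimately show ?thesis
      using assms(2) entourage_structure_subset[of "fst Y" "snd Y" "Id_on (fst Y)"]
      by (simp add: obj_iff)
  qed
  then show ?thesis
    using assms(3) by (simp add: mor_iff bornologous_def)
qed

lemma set_sized_fiber:
  assumes "A \<in> \<U>"
  shows "set_sized \<U> (fiber \<C> forgetful A)"
  by (rule set_sized_subset[OF set_sized_entourage_structures[OF assms]])
    (auto simp: fiber_def obj_iff dest: entourage_structure_carrier)

text \<open>Existence comes from the empty source, whose initial structure contains all relations.
  For uniqueness, the diagonal of a singleton is all of \<open>A \<times> A\<close>, so closure
  under subsets forces every relation to be an entourage.\<close>

lemma singleton_fiber:
  assumes "A \<in> \<U>" "is_singleton A"
  shows "\<exists>!X. X \<in> fiber \<C> forgetful A"
proof
  have "(A, initial_structure A {}) \<in> obj \<C>"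
    using assms(1) by (rule initial_obj) simp
  then show "(A, Pow (A \<times> A)) \<in> fiber \<C> forgetful A"
    by (simp add: fiber_def initial_structure_def Pow_def)
next
  fix X assume X: "X \<in> fiber \<C> forgetful A"
  then have "entourage_structure A (snd X)"
    by (auto simp: fiber_def obj_iff)
  moreover have "Id_on A = A \<times> A"
    using assms(2) by (auto simp: is_singleton_def)
  ultimately have "snd X = Pow (A \<times> A)"
    using entourage_structure_subset[of A "snd X" "A \<times> A"] entourage_structure_Id_on[of A "snd X"]
      entourage_structure_carrier[of A "snd X"] by auto
  then show "X = (A, Pow (A \<times> A))"
    using X by (auto simp: fiber_def prod_eq_iff)
qed

text \<open>The lifted morphisms are the given maps \<open>fs\<close>, as \<open>forgetful\<close>
  leaves morphisms unchanged. A map \<open>f\<close> into the lifting is bornologous once all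
  composites are, because the \<open>fs i\<close>-image of \<open>f(E)\<close> is the image of
  \<open>E\<close> under the composite.\<close>

lemma initial_lifting:
  fixes I :: "'i set"
  assumes "A \<in> \<U>" and Xs: "\<And>i. i \<in> I \<Longrightarrow> Xs i \<in> obj \<C>"
    and fs: "\<And>i. i \<in> I \<Longrightarrow> fs i \<in> A \<rightarrow>\<^sub>E fst (Xs i)"
  shows "initial_lifting \<U> \<C> forgetful A I Xs fs
    (A, initial_structure A ((\<lambda>i. (fs i, Xs i)) ` I)) fs" (is "initial_lifting _ _ _ _ _ _ _ ?B _")
proof -
  have "fs i x \<in> fst (Xs i)" if "i \<in> I" "x \<in> A" for i x
    using fs that by (blast intro: PiE_mem)
  then have B: "?B \<in> obj \<C>"
    using \<open>A \<in> \<U>\<close> Xs by (intro initial_obj) auto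
  have "fs i \<in> mor \<C> ?B (Xs i)" if "i \<in> I" for i
    using that fs by (auto simp: mor_iff bornologous_def initial_structure_def)
  then have "is_source \<C> ?B I Xs fs"
    using B Xs by (simp add: is_source_def)
  moreover have "f \<in> mor \<C> Z ?B"
    if Z: "Z \<in> obj \<C>" and f: "f \<in> fst Z \<rightarrow>\<^sub>E A"
      and comp: "\<And>i. i \<in> I \<Longrightarrow> compose (fst Z) (fs i) f \<in> mor \<C> Z (Xs i)" for Z f
  proof -
    have "map_prod f f ` E \<in> snd ?B" if E: "E \<in> snd Z" for E
    proof -
      have carrier: "E \<subseteq> fst Z \<times> fst Z"
        using Z E by (rule obj_carrier)
      have "map_prod (fs i) (fs i) ` map_prod f f ` E \<in> snd (Xs i)" if "i \<in> I" for i
        using comp[OF that] E unfolding mor_iff bornologous_def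
        by (metis map_prod_image_compose[OF carrier])
      moreover have "map_prod f f ` E \<subseteq> A \<times> A"
        using carrier f by auto
      ultimately show ?thesis
        by (auto simp: initial_structure_def)
    qed
    then show ?thesis
      using f by (simp add: mor_iff bornologous_def)
  qed
  ultimately show ?thesis
    by (simp add: initial_lifting_def initial_source_def is_morphism_iff)
qed

theorem topological: "topological TYPE('i) \<U> \<C> forgetful"
  unfolding topological_def
proof (intro conjI allI impI ballI)
  \<comment> \<open>\<open>forgetful\<close> returns a morphism unchanged and the identities of both
    categories are the same restricted map, so the hypothesis on \<open>f\<close> is already the
    conclusion.\<close>
  show "amnestic \<U> \<C> forgetful"
    by (simp add: amnestic_def)
next
  fix A and I :: "'i set" and Xs fs
  assume "(\<forall>i\<in>I. Xs i \<in> obj \<C>) \<and> is_source (Set_cat \<U>) A I (\<lambda>i. fobj forgetful (Xs i)) fs"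
  then have "A \<in> \<U>" "\<And>i. i \<in> I \<Longrightarrow> Xs i \<in> obj \<C>"
    "\<And>i. i \<in> I \<Longrightarrow> fs i \<in> A \<rightarrow>\<^sub>E fst (Xs i)"
    by (simp_all add: is_source_def)
  then show "\<exists>B gs. initial_lifting \<U> \<C> forgetful A I Xs fs B gs"
    by - (rule exI, rule exI, rule initial_lifting)
next
  fix X Y f
  assume "X \<in> obj \<C>" "Y \<in> obj \<C>"
    and "f \<in> mor (Set_cat \<U>) (fobj forgetful X) (fobj forgetful Y)"
    and "\<forall>x\<in>fobj forgetful X. \<forall>y\<in>fobj forgetful X. f x = f y"
  then show "is_morphism \<C> forgetful X Y f"
    unfolding is_morphism_iff cat_sel by (rule constant_mor)
next
  fix A assume "A \<in> obj (Set_cat \<U>)"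
  then have A: "A \<in> \<U>"
    by simp
  then show "set_sized \<U> (fiber \<C> forgetful A)"
    by (rule set_sized_fiber)
  show "\<exists>!X. X \<in> fiber \<C> forgetful A" if "is_singleton A"
    using A that by (rule singleton_fiber)
qed (rule concrete_category transportable)+

end

section \<open>The four categories as instances\<close>

theorem theorem3p2:
  fixes \<U> :: "'u set set"
  shows "topological TYPE('i) \<U> (Entou \<U>) forgetful \<and>
         topological TYPE('i) \<U> (SCoarse \<U>) forgetful \<and>
         topological TYPE('i) \<U> (QCoarse \<U>) forgetful \<and>
         topological TYPE('i) \<U> (Coarse \<U>) forgetful"
proof (intro conjI)
  have "initially_closed (\<lambda>_ :: 'u space. True)"
    by (rule initially_closed.intro) simp
  \<comment> \<open>The entourage spaces are fitted into the locale by viewing \<open>Entou\<close>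
    as the full subcategory of itself cut out by the constantly true predicate.\<close>
  moreover have "full_subcategory (Entou \<U>) (\<lambda>_. True) = Entou \<U>"
    by (simp add: full_subcategory_def Entou_def)
  ultimately show "topological TYPE('i) \<U> (Entou \<U>) forgetful"
    using initially_closed.topological[of "\<lambda>_. True" \<U>] by simp
  have "initially_closed (\<lambda>(X :: 'u set, \<E>). semi_coarse_structure X \<E>)"
    by (rule initially_closed.intro)
      (auto simp: case_prod_unfold intro!: semi_coarse_structure_initial)
  then show "topological TYPE('i) \<U> (SCoarse \<U>) forgetful"
    unfolding SCoarse_def by (rule initially_closed.topological)
  have "initially_closed (\<lambda>(X :: 'u set, \<E>). quasi_coarse_structure X \<E>)"
    by (rule initially_closed.intro)
      (auto simp: case_prod_unfold intro!: quasi_coarse_structure_initial)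
  then show "topological TYPE('i) \<U> (QCoarse \<U>) forgetful"
    unfolding QCoarse_def by (rule initially_closed.topological)
  have "initially_closed (\<lambda>(X :: 'u set, \<E>). coarse_structure X \<E>)"
    by (rule initially_closed.intro) (auto simp: case_prod_unfold intro!: coarse_structure_initial)
  then show "topological TYPE('i) \<U> (Coarse \<U>) forgetful"
    unfolding Coarse_def by (rule initially_closed.topological)
qed

end
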